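(* For each integer $n\ge 2$ there exists a map $f:\mathbb{R}^2\to\mathbb{R}^2$ such that: (a) $f$ is a differentiable homeomorphism; (b) $f$ has symmetry group $\mathbb{Z}_n$; (c) $\mathrm{Fix}(f)=\{0\}$; (d) the origin is a local attractor for $f$; (e) there exists a periodic orbit of $f$ of minimal period $n$.
   Context: $\mathbb{Z}_n$ acts on $\mathbb{R}^2\simeq\mathbb{C}$ as the group generated by the rotation $R_n\cdot z=e^{2\pi i/n}z$ by $2\pi/n$ around the origin. A map $f:\mathbb{R}^2\to\mathbb{R}^2$ is $\mathbb{Z}_n$-equivariant if $f(\gamma x)=\gamma f(x)$ for all $\gamma\in\mathbb{Z}_n$ and $x\in\mathbb{R}^2$. The symmetry group of $f$ is $\mathbb{Z}_n$ if the identity $f(\gamma x)=\gamma f(x)$ for all $x\in\mathbb{R}^2$ holds for an invertible linear map $\gamma$ of $\mathbb{R}^2$ exactly when $\gamma\in\mathbb{Z}_n$. "Differentiable homeomorphism" means a homeomorphism of $\mathbb{R}^2$ onto $\mathbb{R}^2$ that is (Fréchet) differentiable at every point of $\mathbb{R}^2$. $\mathrm{Fix}(f)$ is the set of fixed points of $f$. A fixed point is a local attractor if it is asymptotically stable (Lyapunov stable, and attracting all points in some neighbourhood of it under forward iteration). *)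

theory Defs
  imports "HOL-Analysis.Analysis"
begin

text \<open>The plane is the type \<^typ>\<open>complex\<close>, with its structure of real normed vector space:
  \<^const>\<open>linear\<close> and \<^const>\<open>differentiable\<close> below both refer to real scalars.\<close>

definition rotation :: "nat \<Rightarrow> complex \<Rightarrow> complex" where
  "rotation n z = exp (2 * of_real pi * \<i> / of_nat n) * z"

text \<open>The group generated by \<open>rotation n\<close> consists of its integer powers; negative powers are
  powers of the inverse map.\<close>

definition rotation_group :: "nat \<Rightarrow> (complex \<Rightarrow> complex) set" where
  "rotation_group n = {rotation n ^^ k | k. True} \<union> {inv (rotation n) ^^ k | k. True}"

definition symmetry_group :: "('a::real_vector \<Rightarrow> 'a) \<Rightarrow> ('a \<Rightarrow> 'a) set" where
  "symmetry_group f = {\<gamma>. linear \<gamma> \<and> bij \<gamma> \<and> (\<forall>x. f (\<gamma> x) = \<gamma> (f x))}"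

definition differentiable_homeomorphism :: "('a::real_normed_vector \<Rightarrow> 'a) \<Rightarrow> bool" where
  "differentiable_homeomorphism f \<longleftrightarrow>
     (\<exists>g. homeomorphism UNIV UNIV f g) \<and> (\<forall>x. f differentiable (at x))"

definition Fix :: "('a \<Rightarrow> 'a) \<Rightarrow> 'a set" where
  "Fix f = {x. f x = x}"

definition lyapunov_stable :: "('a::metric_space \<Rightarrow> 'a) \<Rightarrow> 'a \<Rightarrow> bool" where
  "lyapunov_stable f p \<longleftrightarrow>
     (\<forall>\<epsilon>>0. \<exists>\<delta>>0. \<forall>x. dist x p < \<delta> \<longrightarrow> (\<forall>k. dist ((f ^^ k) x) p < \<epsilon>))"

definition locally_attracting :: "('a::metric_space \<Rightarrow> 'a) \<Rightarrow> 'a \<Rightarrow> bool" where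
  "locally_attracting f p \<longleftrightarrow>
     (\<exists>\<delta>>0. \<forall>x. dist x p < \<delta> \<longrightarrow> (\<lambda>k. (f ^^ k) x) \<longlonglongrightarrow> p)"

definition local_attractor :: "('a::metric_space \<Rightarrow> 'a) \<Rightarrow> 'a \<Rightarrow> bool" where
  "local_attractor f p \<longleftrightarrow> p \<in> Fix f \<and> lyapunov_stable f p \<and> locally_attracting f p"

definition has_minimal_period :: "('a \<Rightarrow> 'a) \<Rightarrow> 'a \<Rightarrow> nat \<Rightarrow> bool" where
  "has_minimal_period f x n \<longleftrightarrow>
     0 < n \<and> (f ^^ n) x = x \<and> (\<forall>k. 0 < k \<and> k < n \<longrightarrow> (f ^^ k) x \<noteq> x)"

end

theory Submission
  imports Defs
begin

text \<open>
  The witness is \<open>f z = \<omega> \<rho>(z) z\<close>, where \<open>\<omega> = exp (2\<pi>\<i>/n)\<close> and \<open>\<rho>\<close> is a positive real function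
  that is invariant under multiplication by \<open>\<omega>\<close>. Such a map turns every ray from the origin by
  the angle \<open>2\<pi>/n\<close> while rescaling it, and most of the claims can be read off from \<open>\<rho>\<close>. There is
  no fixed point besides 0, because \<open>\<omega>\<close> is not a positive real number when \<open>n \<ge> 2\<close>. If \<open>\<rho>(1) = 1\<close>,
  the powers of \<open>\<omega>\<close> form an orbit of minimal period \<open>n\<close>. If \<open>\<rho>\<close> is bounded by a constant below 1
  near 0, the origin attracts. If \<open>\<rho>\<close> is continuous and weakly increasing along rays, \<open>f\<close> is a
  continuous bijection of the plane, hence a homeomorphism by invariance of domain. At 0 the map is
  differentiable because \<open>f z / z = \<omega> \<rho>(z)\<close> has a limit there.

  What remains is to choose \<open>\<rho>\<close> so that \<open>f\<close> has no symmetry besides the rotations, and for this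
  \<open>\<rho>(z) = (4 + |z|\<^sup>2 + B(z)) / 8\<close> is used, where
  \<open>B(z) = 2|z|\<^bsup>2n\<^esup> + |z|\<^sup>n Re(z\<^sup>n) + Im(z\<^bsup>2n\<^esup>)\<close> is nonnegative and homogeneous of degree \<open>2n\<close>.
  Let a linear bijection \<open>\<gamma>\<close> commute with \<open>f\<close>. Comparing both sides at \<open>t z\<close> for \<open>t \<rightarrow> 0\<close> shows that
  \<open>\<gamma>\<close> commutes with \<open>\<omega>\<close>, and then that \<open>\<rho> \<circ> \<gamma> = \<rho>\<close>
  (\<open>linear_symmetry_preserves_radial_factor\<close>). The parts of degree 2 and \<open>2n\<close> are preserved
  separately (\<open>radial_factor_symmetry_separates\<close>). The first makes \<open>\<gamma>\<close> an isometry, that is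
  \<open>z \<mapsto> c z\<close> or \<open>z \<mapsto> c cnj z\<close> with \<open>|c| = 1\<close>. The second excludes the reflections and forces
  \<open>c\<^sup>n = 1\<close>, because on the unit circle \<open>B\<close> is \<open>2 + cos \<phi> + sin 2\<phi>\<close> with \<open>\<phi> = n arg z\<close>, a function
  of \<open>\<phi>\<close> whose graph has neither a proper translational period nor an axis of symmetry.
  Reflections have to be excluded through \<open>B\<close>, since for \<open>n = 2\<close> they commute with \<open>\<omega> = -1\<close>.
\<close>

section \<open>Rescaling the rays from the origin\<close>

text \<open>If two points have the same image they lie on one ray. The one nearer to the origin has
  the smaller norm and at most as large a factor, so its image would be strictly shorter.\<close>

lemma scaleR_image_inj:
  fixes \<rho> :: "'a::real_normed_vector \<Rightarrow> real"
  assumes pos: "\<And>z. 0 < \<rho> z"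
    and mono: "\<And>s t z. 0 \<le> s \<Longrightarrow> s \<le> t \<Longrightarrow> \<rho> (s *\<^sub>R z) \<le> \<rho> (t *\<^sub>R z)"
  shows "inj (\<lambda>z. \<rho> z *\<^sub>R z)"
proof -
  have norm_le: "norm z \<le> norm w" if eq: "\<rho> z *\<^sub>R z = \<rho> w *\<^sub>R w" for z w
  proof (rule ccontr)
    assume less: "\<not> norm z \<le> norm w"
    define s where "s = \<rho> z / \<rho> w"
    have w: "w = s *\<^sub>R z"
      using arg_cong[OF eq, of "\<lambda>v. (1 / \<rho> w) *\<^sub>R v"] pos[of w] by (simp add: s_def)
    have s0: "0 < s"
      using pos by (simp add: s_def)
    have "s < 1"
      using less w s0 by (simp add: mult_less_cancel_right2 not_le)
    then have "\<rho> w \<le> \<rho> z"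
      using mono[of s 1 z] s0 w by simp
    with \<open>s < 1\<close> show False
      using pos[of w] by (simp add: s_def)
  qed
  show ?thesis
  proof (rule injI)
    fix z w assume eq: "\<rho> z *\<^sub>R z = \<rho> w *\<^sub>R w"
    have "norm z = norm w"
      using norm_le[OF eq] norm_le[OF eq[symmetric]] by simp
    moreover have "\<rho> z * norm z = \<rho> w * norm w"
      using arg_cong[OF eq, of norm] pos[of z] pos[of w] by simp
    ultimately show "z = w"
      using eq pos[of w] by (cases "norm w = 0") auto
  qed
qed

text \<open>On the ray through \<open>w\<close> the scale \<open>t \<rho>(t w)\<close> starts at 0, and it reaches 1 by the time
  \<open>t = 1 / \<rho>(0)\<close> because \<open>\<rho>(t w) \<ge> \<rho>(0)\<close>. The intermediate value theorem supplies the preimage.\<close>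

lemma scaleR_image_surj:
  fixes \<rho> :: "'a::real_normed_vector \<Rightarrow> real"
  assumes cont: "continuous_on UNIV \<rho>"
    and pos: "\<And>z. 0 < \<rho> z"
    and mono: "\<And>s t z. 0 \<le> s \<Longrightarrow> s \<le> t \<Longrightarrow> \<rho> (s *\<^sub>R z) \<le> \<rho> (t *\<^sub>R z)"
  shows "surj (\<lambda>z. \<rho> z *\<^sub>R z)"
unfolding surj_def
proof
  fix w
  let ?T = "1 / \<rho> 0"
  have T: "0 \<le> ?T"
    using pos[of 0] by simp
  have "continuous_on {0..?T} (\<lambda>t. t * \<rho> (t *\<^sub>R w))"
    by (intro continuous_intros continuous_on_compose2[OF cont]) auto
  moreover have "1 \<le> ?T * \<rho> (?T *\<^sub>R w)"
    using mono[of 0 ?T w] T pos[of 0] by (simp add: field_simps)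
  ultimately obtain t where "t * \<rho> (t *\<^sub>R w) = 1"
    using IVT'[of "\<lambda>t. t * \<rho> (t *\<^sub>R w)" 0 1 ?T] T by auto
  then show "\<exists>z. w = \<rho> z *\<^sub>R z"
    by (intro exI[of _ "t *\<^sub>R w"]) (simp add: mult.commute)
qed

section \<open>Contraction near a fixed point\<close>

lemma local_attractor_zero_if_norm_contracting:
  fixes f :: "'a::real_normed_vector \<Rightarrow> 'a"
  assumes "0 < r" "0 \<le> q" "q < 1"
    and contr: "\<And>x. norm x < r \<Longrightarrow> norm (f x) \<le> q * norm x"
  shows "local_attractor f 0"
proof -
  have iter: "norm ((f ^^ k) x) \<le> q ^ k * norm x" if x: "norm x < r" for k x
  proof (induction k)
    case (Suc k)
    have "q ^ k * norm x \<le> norm x"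
      using assms by (simp add: mult_left_le_one_le power_le_one)
    then have "norm ((f ^^ k) x) < r"
      using Suc.IH x by linarith
    then have "norm ((f ^^ Suc k) x) \<le> q * norm ((f ^^ k) x)"
      using contr by simp
    also have "\<dots> \<le> q * (q ^ k * norm x)"
      using Suc.IH \<open>0 \<le> q\<close> by (rule mult_left_mono)
    finally show ?case
      by simp
  qed simp
  have "f 0 = 0"
    using contr[of 0] \<open>0 < r\<close> by simp
  moreover have "lyapunov_stable f 0"
    unfolding lyapunov_stable_def
  proof (intro allI impI)
    fix e :: real assume "0 < e"
    have "norm ((f ^^ k) x) < e" if "norm x < min r e" for x k
    proof -
      have "q ^ k * norm x \<le> norm x"
        using assms by (simp add: mult_left_le_one_le power_le_one)
      then show ?thesis
        using iter[of x k] that by simp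
    qed
    then show "\<exists>d>0. \<forall>x. dist x 0 < d \<longrightarrow> (\<forall>k. dist ((f ^^ k) x) 0 < e)"
      using \<open>0 < e\<close> \<open>0 < r\<close> by (intro exI[of _ "min r e"]) auto
  qed
  moreover have "(\<lambda>k. (f ^^ k) x) \<longlonglongrightarrow> 0" if "norm x < r" for x
  proof (rule Lim_null_comparison)
    show "\<forall>\<^sub>F k in sequentially. norm ((f ^^ k) x) \<le> q ^ k * norm x"
      using iter[OF that] by simp
    show "(\<lambda>k. q ^ k * norm x) \<longlonglongrightarrow> 0"
      using assms by (intro tendsto_mult_left_zero LIMSEQ_power_zero) simp
  qed
  ultimately show ?thesis
    using \<open>0 < r\<close> by (auto simp: local_attractor_def Fix_def locally_attracting_def)
qed

section \<open>Linear isometries and rotations of the plane\<close>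

text \<open>With \<open>c = \<gamma> 1\<close> and \<open>\<gamma> \<i> = c e\<close>, preservation of the norms of \<open>\<i>\<close> and \<open>1 + \<i>\<close> says that
  \<open>e\<close> is a unit vector orthogonal to 1, which leaves only \<open>e = \<plusminus>\<i>\<close>.\<close>

lemma linear_isometry_complex_cases:
  fixes \<gamma> :: "complex \<Rightarrow> complex"
  assumes lin: "linear \<gamma>" and iso: "\<And>z. norm (\<gamma> z) = norm z"
  obtains c where "norm c = 1" "\<gamma> = (\<lambda>z. c * z)"
        | c where "norm c = 1" "\<gamma> = (\<lambda>z. c * cnj z)"
proof -
  define c where "c = \<gamma> 1"
  define e where "e = cnj c * \<gamma> \<i>"
  have c: "norm c = 1"
    using iso[of 1] by (simp add: c_def)
  then have cc: "c * cnj c = 1"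
    by (simp add: complex_norm_square[symmetric])
  have gi: "\<gamma> \<i> = c * e"
    using cc by (simp add: e_def flip: mult.assoc)
  have split: "\<gamma> z = c * (of_real (Re z) + of_real (Im z) * e)" for z
  proof -
    have "z = Re z *\<^sub>R 1 + Im z *\<^sub>R \<i>"
      by (simp add: complex_eq_iff)
    then have "\<gamma> z = Re z *\<^sub>R \<gamma> 1 + Im z *\<^sub>R \<gamma> \<i>"
      by (metis lin linear_add linear_scale)
    then show ?thesis
      by (simp add: gi c_def[symmetric] scaleR_conv_of_real algebra_simps)
  qed
  have "norm e = 1"
    using iso[of \<i>] gi c by (simp add: norm_mult)
  moreover have "norm (1 + e) = norm (1 + \<i>)"
    using iso[of "1 + \<i>"] split[of "1 + \<i>"] c by (simp add: norm_mult)
  ultimately have "(Re e)\<^sup>2 + (Im e)\<^sup>2 = 1" "(1 + Re e)\<^sup>2 + (Im e)\<^sup>2 = 2"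
    by (simp_all add: cmod_def real_sqrt_eq_1_iff)
  moreover from this have "Re e = 0"
    by (simp add: power2_sum)
  ultimately have "Re e = 0" "(Im e)\<^sup>2 = 1"
    by simp_all
  then have "e = \<i> \<or> e = - \<i>"
    by (auto simp: complex_eq_iff power2_eq_1_iff)
  then show thesis
  proof
    assume "e = \<i>"
    then have "\<gamma> = (\<lambda>z. c * z)"
      using split by (auto simp: fun_eq_iff complex_eq_iff)
    with c show thesis by (rule that(1))
  next
    assume "e = - \<i>"
    then have "\<gamma> = (\<lambda>z. c * cnj z)"
      using split by (auto simp: fun_eq_iff complex_eq_iff)
    with c show thesis by (rule that(2))
  qed
qed

abbreviation unit_root :: "nat \<Rightarrow> complex" where
  "unit_root n \<equiv> exp (2 * of_real pi * \<i> / of_nat n)"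

lemma unit_root_power: "0 < n \<Longrightarrow> unit_root n ^ n = 1"
  by (simp flip: exp_of_nat_mult)

lemma funpow_mult_left: "((\<lambda>z. c * z) ^^ k) = (\<lambda>z::complex. c ^ k * z)"
  by (induction k) (auto simp: fun_eq_iff)

lemma rotation_group_eq:
  assumes "0 < n"
  shows "rotation_group n = {(\<lambda>z. c * z) | c. c ^ n = 1}"
proof -
  have rot: "rotation n = (\<lambda>z. unit_root n * z)"
    by (simp add: rotation_def fun_eq_iff)
  have inv_rot: "inv (rotation n) = (\<lambda>z. inverse (unit_root n) * z)"
    by (rule inv_equality) (simp_all add: rot flip: mult.assoc)
  have iterate: "rotation n ^^ k = (\<lambda>z. unit_root n ^ k * z)"
    "inv (rotation n) ^^ k = (\<lambda>z. inverse (unit_root n) ^ k * z)" for k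
    by (simp_all only: inv_rot) (simp_all only: rot funpow_mult_left)
  have root: "unit_root n ^ n = 1"
    using unit_root_power[OF assms] .
  show ?thesis
  proof (intro equalityI subsetI)
    fix \<gamma> assume "\<gamma> \<in> rotation_group n"
    then obtain k where "\<gamma> = rotation n ^^ k \<or> \<gamma> = inv (rotation n) ^^ k"
      by (auto simp: rotation_group_def)
    then have "\<gamma> = (\<lambda>z. unit_root n ^ k * z) \<or> \<gamma> = (\<lambda>z. inverse (unit_root n) ^ k * z)"
      by (simp only: iterate)
    moreover have "(unit_root n ^ k) ^ n = 1"
      using root by (metis mult.commute power_mult power_one)
    moreover have "(inverse (unit_root n) ^ k) ^ n = 1"
      using root by (metis inverse_1 mult.commute power_inverse power_mult power_one)
    ultimately show "\<gamma> \<in> {(\<lambda>z. c * z) | c. c ^ n = 1}"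
      by blast
  next
    fix \<gamma> :: "complex \<Rightarrow> complex"
    assume "\<gamma> \<in> {(\<lambda>z. c * z) | c. c ^ n = 1}"
    then obtain c where \<gamma>: "\<gamma> = (\<lambda>z. c * z)" and c: "c ^ n = 1"
      by blast
    have le: "1 \<le> n"
      using assms by simp
    have "c \<in> {exp (2 * of_real pi * \<i> * of_nat k / of_nat n) | k. k < n}"
      using c unfolding complex_roots_unity[symmetric, OF le] by simp
    then obtain k where "c = exp (2 * of_real pi * \<i> * of_nat k / of_nat n)"
      by blast
    then have "c = unit_root n ^ k"
      by (simp add: mult_ac flip: exp_of_nat_mult)
    then have "\<gamma> = rotation n ^^ k"
      unfolding \<gamma> iterate by simp
    then show "\<gamma> \<in> rotation_group n"
      unfolding rotation_group_def by blast
  qed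
qed

section \<open>The map and its dynamics\<close>

text \<open>The first term keeps the form nonnegative. The harmonic \<open>Re(z\<^sup>n)\<close> detects the rotations by
  \<open>2\<pi>/n\<close> and the harmonic \<open>Im(z\<^bsup>2n\<^esup>)\<close>, in a different phase, breaks the reflections that preserve
  the first one. The factor \<open>|z|\<^sup>n\<close> makes all terms homogeneous of the same degree.\<close>

definition chiral_form :: "nat \<Rightarrow> complex \<Rightarrow> real" where
  "chiral_form n z = 2 * norm z ^ (2 * n) + norm z ^ n * Re (z ^ n) + Im (z ^ (2 * n))"

text \<open>The value at 0 is \<open>1/2\<close>, so that the origin attracts. The denominator 8 gives the value 1 at
  the point 1, where \<open>chiral_form\<close> is 3.\<close>

definition radial_factor :: "nat \<Rightarrow> complex \<Rightarrow> real" where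
  "radial_factor n z = (4 + (norm z)\<^sup>2 + chiral_form n z) / 8"

definition rotated_radial_map :: "nat \<Rightarrow> complex \<Rightarrow> complex" where
  "rotated_radial_map n z = rotation n (radial_factor n z *\<^sub>R z)"

lemma chiral_form_bounds:
  "0 \<le> chiral_form n z" "chiral_form n z \<le> 4 * norm z ^ (2 * n)"
proof -
  have "\<bar>Re (z ^ n)\<bar> \<le> norm z ^ n"
    using abs_Re_le_cmod[of "z ^ n"] by (simp add: norm_power)
  then have "norm z ^ n * \<bar>Re (z ^ n)\<bar> \<le> norm z ^ n * norm z ^ n"
    by (rule mult_left_mono) simp
  then have "\<bar>norm z ^ n * Re (z ^ n)\<bar> \<le> norm z ^ (2 * n)"
    by (simp add: abs_mult mult_2 power_add)
  moreover have "\<bar>Im (z ^ (2 * n))\<bar> \<le> norm z ^ (2 * n)"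
    using abs_Im_le_cmod[of "z ^ (2 * n)"] by (simp add: norm_power)
  ultimately show "0 \<le> chiral_form n z" "chiral_form n z \<le> 4 * norm z ^ (2 * n)"
    unfolding chiral_form_def by linarith+
qed

lemma chiral_form_scaleR:
  assumes "0 \<le> t"
  shows "chiral_form n (t *\<^sub>R z) = t ^ (2 * n) * chiral_form n z"
proof -
  have t: "t ^ (2 * n) = t ^ n * t ^ n"
    by (simp add: mult_2 power_add)
  have "norm (t *\<^sub>R z) ^ n * Re ((t *\<^sub>R z) ^ n) = t ^ (2 * n) * (norm z ^ n * Re (z ^ n))"
    using assms unfolding t by (simp add: power_mult_distrib)
  moreover have "norm (t *\<^sub>R z) ^ (2 * n) = t ^ (2 * n) * norm z ^ (2 * n)"
    using assms by (simp add: power_mult_distrib)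
  ultimately show ?thesis
    by (simp add: chiral_form_def distrib_left)
qed

lemma chiral_form_unit:
  assumes "norm z = 1"
  shows "chiral_form n z = 2 + Re (z ^ n) + Im ((z ^ n)\<^sup>2)"
  using assms by (simp add: chiral_form_def mult.commute flip: power_mult)

lemma radial_factor_scaleR:
  assumes "0 \<le> t"
  shows "radial_factor n (t *\<^sub>R z) = (4 + t\<^sup>2 * (norm z)\<^sup>2 + t ^ (2 * n) * chiral_form n z) / 8"
  using assms by (simp add: radial_factor_def chiral_form_scaleR power_mult_distrib)

lemma radial_factor_pos: "0 < radial_factor n z"
  using chiral_form_bounds(1)[of n z] zero_le_power2[of "norm z"]
  unfolding radial_factor_def by (simp add: add_pos_nonneg)

text \<open>Along a ray the factor is a polynomial in the distance from the origin with nonnegative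
  coefficients.\<close>

lemma radial_factor_mono:
  assumes "0 \<le> s" "s \<le> t"
  shows "radial_factor n (s *\<^sub>R z) \<le> radial_factor n (t *\<^sub>R z)"
  using assms chiral_form_bounds(1)[of n z]
  by (auto simp: radial_factor_scaleR intro!: add_mono mult_right_mono power_mono)

lemma continuous_radial_factor: "continuous_on UNIV (radial_factor n)"
  unfolding radial_factor_def chiral_form_def by (intro continuous_intros) auto

lemma radial_factor_rotate:
  assumes "0 < n" "c ^ n = 1"
  shows "radial_factor n (c * z) = radial_factor n z"
proof -
  \<comment> \<open>A root of unity lies on the unit circle, so multiplication by it preserves the norm terms.\<close>
  have "norm c = 1"
    using assms power_eq_1_iff by blast
  then show ?thesis
    using assms
    by (simp add: radial_factor_def chiral_form_def norm_mult power_mult_distrib power_mult mult.commute[of 2])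
qed

lemma homeomorphism_rotated_radial_map:
  assumes "0 < n"
  shows "\<exists>g. homeomorphism UNIV UNIV (rotated_radial_map n) g"
proof -
  let ?h = "\<lambda>z. radial_factor n z *\<^sub>R z"
  have eq: "rotated_radial_map n = rotation n \<circ> ?h"
    by (auto simp: rotated_radial_map_def)
  have "bij (rotation n)"
    by (rule bij_betw_byWitness[where f' = "\<lambda>z. inverse (unit_root n) * z"])
      (auto simp: rotation_def simp flip: mult.assoc)
  moreover have "bij ?h"
    by (intro bijI scaleR_image_inj scaleR_image_surj continuous_radial_factor
        radial_factor_pos radial_factor_mono)
  ultimately have "bij (rotated_radial_map n)"
    unfolding eq by (intro bij_comp)
  moreover have "continuous_on UNIV (rotated_radial_map n)"
    unfolding rotated_radial_map_def rotation_def
    by (intro continuous_intros continuous_radial_factor)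
  ultimately show ?thesis
    using invariance_of_domain_homeomorphism[of UNIV "rotated_radial_map n"]
    by (metis bij_is_inj bij_is_surj open_UNIV order_refl)
qed

text \<open>The norm fails to be differentiable at 0. There the quotient \<open>f z / z\<close> extends continuously,
  so \<open>f\<close> even has a complex derivative.\<close>

lemma differentiable_rotated_radial_map: "rotated_radial_map n differentiable (at z)"
proof (cases "z = 0")
  case True
  have "isCont (radial_factor n) 0"
    using continuous_radial_factor by (simp add: continuous_on_eq_continuous_at)
  then have "((\<lambda>y. unit_root n * of_real (radial_factor n y)) \<longlongrightarrow>
      unit_root n * of_real (radial_factor n 0)) (at 0)"
    by (intro tendsto_intros) (simp add: isCont_def)
  moreover have "\<forall>\<^sub>F y in at 0. unit_root n * of_real (radial_factor n y) =
      (rotated_radial_map n y - rotated_radial_map n 0) / (y - 0)"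
    by (auto simp: eventually_at_filter rotated_radial_map_def rotation_def scaleR_conv_of_real)
  ultimately have "(rotated_radial_map n has_field_derivative
      unit_root n * of_real (radial_factor n 0)) (at 0)"
    unfolding has_field_derivative_iff by (rule Lim_transform_eventually)
  then show ?thesis
    using True by (auto simp: has_field_derivative_def differentiable_def)
next
  case False
  then have [derivative_intros]: "norm differentiable (at z)"
    by (rule differentiable_norm_at)
  have "(\<lambda>y. Re (y ^ k)) differentiable (at z)" "(\<lambda>y. Im (y ^ k)) differentiable (at z)" for k
    unfolding differentiable_def by (auto intro!: exI derivative_eq_intros)
  then have "radial_factor n differentiable (at z)"
    unfolding radial_factor_def chiral_form_def using \<open>norm differentiable (at z)\<close>
    by (auto intro!: derivative_intros)
  then show ?thesis
    unfolding rotated_radial_map_def rotation_def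
    by (intro derivative_intros)
qed

text \<open>A nonzero fixed point would give \<open>\<omega> \<rho>(z) = 1\<close>. Taking norms, \<open>\<rho>(z) = 1\<close>, hence \<open>\<omega> = 1\<close>.\<close>

lemma Fix_rotated_radial_map:
  assumes "2 \<le> n"
  shows "Fix (rotated_radial_map n) = {0}"
proof -
  have "z = 0" if "rotated_radial_map n z = z" for z
  proof (rule ccontr)
    assume "z \<noteq> 0"
    then have *: "unit_root n * of_real (radial_factor n z) = 1"
      using that by (simp add: rotated_radial_map_def rotation_def scaleR_conv_of_real)
    then have "norm (unit_root n) * radial_factor n z = 1"
      using radial_factor_pos[of n z] by (metis norm_mult norm_of_real abs_of_pos norm_one)
    then have "unit_root n = 1"
      using * by simp
    then show False
      using complex_root_unity_eq_1[of n 1] assms by simp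
  qed
  then show ?thesis
    by (auto simp: Fix_def rotated_radial_map_def rotation_def)
qed

lemma local_attractor_rotated_radial_map:
  assumes "0 < n"
  shows "local_attractor (rotated_radial_map n) 0"
proof (rule local_attractor_zero_if_norm_contracting[of "1 / 2" "3 / 4"])
  fix z :: complex
  assume z: "norm z < 1 / 2"
  have sq: "(norm z)\<^sup>2 \<le> (1 / 2)\<^sup>2"
    using z by (intro power_mono) auto
  have "norm z ^ (2 * n) \<le> (norm z)\<^sup>2"
    using z assms by (intro power_decreasing) auto
  then have "radial_factor n z \<le> 3 / 4"
    using chiral_form_bounds(2)[of n z] sq
    unfolding radial_factor_def by (simp add: power2_eq_square)
  moreover have "norm (rotated_radial_map n z) = radial_factor n z * norm z"
    using radial_factor_pos[of n z] by (simp add: rotated_radial_map_def rotation_def norm_mult)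
  ultimately show "norm (rotated_radial_map n z) \<le> 3 / 4 * norm z"
    using mult_right_mono[of "radial_factor n z" "3 / 4" "norm z"] by simp
qed simp_all

lemma minimal_period_rotated_radial_map:
  assumes "0 < n"
  shows "has_minimal_period (rotated_radial_map n) 1 n"
proof -
  have one: "radial_factor n 1 = 1"
    by (simp add: radial_factor_def chiral_form_def)
  have "radial_factor n (unit_root n ^ k) = 1" for k
  proof -
    have "(unit_root n ^ k) ^ n = 1"
      using unit_root_power[OF assms] by (metis mult.commute power_mult power_one)
    then show ?thesis
      using radial_factor_rotate[OF assms, of "unit_root n ^ k" 1] one by simp
  qed
  then have orbit: "(rotated_radial_map n ^^ k) 1 = unit_root n ^ k" for k
    by (induction k) (simp_all add: rotated_radial_map_def rotation_def)
  have "unit_root n ^ k \<noteq> 1" if "0 < k" "k < n" for k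
  proof -
    have "\<not> n dvd k"
      using that by (auto dest: dvd_imp_le)
    moreover have "unit_root n ^ k = exp (2 * of_real pi * \<i> * of_nat k / of_nat n)"
      by (simp add: mult_ac flip: exp_of_nat_mult)
    ultimately show ?thesis
      using complex_root_unity_eq_1[of n k] assms by simp
  qed
  then show ?thesis
    using assms unit_root_power[OF assms] by (simp add: has_minimal_period_def orbit)
qed

section \<open>The symmetry group\<close>

lemma cis_eq_power: "0 < n \<Longrightarrow> cis t = cis (t / real n) ^ n"
  by (simp add: Complex.DeMoivre)

text \<open>The two equations compare \<open>v \<mapsto> Re (u v) + Im ((u v)\<^sup>2)\<close> with its value for \<open>u = 1\<close> at the
  antipodal points \<open>v = 1\<close> and \<open>v = -1\<close>. The quadratic harmonic is the same at both points, so
  subtracting isolates the linear one.\<close>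

lemma eq_1_if_harmonics_agree:
  assumes "norm u = 1"
    and "Re u + Im (u\<^sup>2) = 1" "- Re u + Im (u\<^sup>2) = - 1"
  shows "u = 1"
proof -
  have "Re u = 1"
    using assms(2,3) by linarith
  moreover from this have "Im u = 0"
    using assms(1) by (simp add: cmod_def)
  ultimately show ?thesis
    by (simp add: complex_eq_iff)
qed

lemma chiral_form_rotation_symmetry:
  assumes n: "0 < n" and c: "norm c = 1"
    and inv: "\<And>z. chiral_form n (c * z) = chiral_form n z"
  shows "c ^ n = 1"
proof (rule eq_1_if_harmonics_agree)
  show "norm (c ^ n) = 1"
    using c by (simp add: norm_power)
  \<comment> \<open>Every point of the unit circle is an \<open>n\<close>-th power, so the invariance passes to the powers.\<close>
  have harm: "Re (c ^ n * cis t) + Im ((c ^ n * cis t)\<^sup>2) = Re (cis t) + Im ((cis t)\<^sup>2)" for t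
    using inv[of "cis (t / n)"] c
    by (simp add: chiral_form_unit norm_mult power_mult_distrib cis_eq_power[OF n, of t])
  show "Re (c ^ n) + Im ((c ^ n)\<^sup>2) = 1"
    using harm[of 0] by simp
  show "- Re (c ^ n) + Im ((c ^ n)\<^sup>2) = - 1"
    using harm[of pi] by simp
qed

text \<open>The points \<open>1\<close> and \<open>-1\<close> force \<open>c\<^sup>n = 1\<close> as for rotations. The reflection then acts on \<open>n\<close>-th
  powers as conjugation, which reverses the sign of the harmonic \<open>Im (v\<^sup>2)\<close>; at \<open>v = exp (\<i>\<pi>/4)\<close>
  this harmonic is 1.\<close>

lemma chiral_form_no_reflection_symmetry:
  assumes n: "0 < n" and c: "norm c = 1"
  shows "\<exists>z. chiral_form n (c * cnj z) \<noteq> chiral_form n z"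
proof (rule ccontr)
  assume "\<nexists>z. chiral_form n (c * cnj z) \<noteq> chiral_form n z"
  then have inv: "chiral_form n (c * cnj z) = chiral_form n z" for z
    by blast
  have harm: "Re (c ^ n * cnj (cis t)) + Im ((c ^ n * cnj (cis t))\<^sup>2)
      = Re (cis t) + Im ((cis t)\<^sup>2)" for t
    using inv[of "cis (t / n)"] c
    by (simp add: chiral_form_unit norm_mult power_mult_distrib cis_eq_power[OF n, of t]
        del: cis_cnj)
  have "c ^ n = 1"
  proof (rule eq_1_if_harmonics_agree)
    show "norm (c ^ n) = 1"
      using c by (simp add: norm_power)
    show "Re (c ^ n) + Im ((c ^ n)\<^sup>2) = 1"
      using harm[of 0] by simp
    show "- Re (c ^ n) + Im ((c ^ n)\<^sup>2) = - 1"
      using harm[of pi] by simp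
  qed
  then show False
    using harm[of "pi / 4"] by (simp add: power2_eq_square cos_45 sin_45)
qed

text \<open>Evaluated at \<open>t z\<close> and divided by \<open>t\<close>, the symmetry says
  \<open>\<rho>(t \<gamma> z) \<omega> \<gamma> z = \<rho>(t z) \<gamma> (\<omega> z)\<close>. As \<open>t \<rightarrow> 0\<close> both factors tend to \<open>\<rho>(0) > 0\<close>, so \<open>\<gamma>\<close> commutes
  with \<open>\<omega>\<close>. Then \<open>t = 1\<close> gives equality of the factors.\<close>

lemma linear_symmetry_preserves_radial_factor:
  assumes lin: "linear \<gamma>" and bij: "bij \<gamma>"
    and comm: "\<And>z. rotated_radial_map n (\<gamma> z) = \<gamma> (rotated_radial_map n z)"
  shows "radial_factor n (\<gamma> z) = radial_factor n z"
proof -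
  let ?w = "unit_root n"
  have scaled: "radial_factor n (t *\<^sub>R \<gamma> z) *\<^sub>R (?w * \<gamma> z) = radial_factor n (t *\<^sub>R z) *\<^sub>R \<gamma> (?w * z)"
    if "t \<noteq> 0" for t
  proof -
    have "t *\<^sub>R (radial_factor n (t *\<^sub>R \<gamma> z) *\<^sub>R (?w * \<gamma> z)) = rotated_radial_map n (\<gamma> (t *\<^sub>R z))"
      by (simp add: rotated_radial_map_def rotation_def linear_scale[OF lin] mult.commute)
    also have "\<dots> = \<gamma> ((t * radial_factor n (t *\<^sub>R z)) *\<^sub>R (?w * z))"
      unfolding comm by (simp add: rotated_radial_map_def rotation_def mult.commute)
    also have "\<dots> = t *\<^sub>R (radial_factor n (t *\<^sub>R z) *\<^sub>R \<gamma> (?w * z))"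
      by (simp add: linear_scale[OF lin])
    finally show ?thesis
      using that by (simp only: scaleR_cancel_left) simp
  qed
  have lim: "((\<lambda>t. radial_factor n (t *\<^sub>R x) *\<^sub>R y) \<longlongrightarrow> radial_factor n 0 *\<^sub>R y) (at 0)" for x y :: complex
  proof -
    have "continuous_on UNIV (\<lambda>t. radial_factor n (t *\<^sub>R x) *\<^sub>R y)"
      by (intro continuous_intros continuous_on_compose2[OF continuous_radial_factor]) auto
    then show ?thesis
      by (simp add: continuous_on_def) (metis scaleR_zero_left)
  qed
  have "((\<lambda>t. radial_factor n (t *\<^sub>R z) *\<^sub>R \<gamma> (?w * z)) \<longlongrightarrow> radial_factor n 0 *\<^sub>R (?w * \<gamma> z)) (at 0)"
    by (rule Lim_transform_eventually[OF lim[of "\<gamma> z"]])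
      (use scaled in \<open>auto simp: eventually_at_filter\<close>)
  then have "radial_factor n 0 *\<^sub>R (?w * \<gamma> z) = radial_factor n 0 *\<^sub>R \<gamma> (?w * z)"
    using lim by (rule LIM_unique)
  then have rot: "\<gamma> (?w * z) = ?w * \<gamma> z"
    using radial_factor_pos[of n 0] by simp
  show ?thesis
  proof (cases "\<gamma> z = 0")
    case True
    then have "z = 0"
      using bij lin by (metis bij_is_inj injD linear_0)
    with True show ?thesis by simp
  next
    case False
    then show ?thesis
      using scaled[of 1] rot by simp
  qed
qed

text \<open>Both sides of \<open>\<rho>(\<gamma> (t z)) = \<rho>(t z)\<close> are polynomials in \<open>t\<close> with terms of degree 0, 2 and
  \<open>2n > 2\<close>. The values \<open>t = 1\<close> and \<open>t = 2\<close> already determine the last two coefficients.\<close>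

lemma radial_factor_symmetry_separates:
  assumes n: "2 \<le> n" and lin: "linear \<gamma>"
    and inv: "\<And>z. radial_factor n (\<gamma> z) = radial_factor n z"
  shows "norm (\<gamma> z) = norm z" "chiral_form n (\<gamma> z) = chiral_form n z"
proof -
  define u where "u = (norm (\<gamma> z))\<^sup>2 - (norm z)\<^sup>2"
  define v where "v = chiral_form n (\<gamma> z) - chiral_form n z"
  have eq: "t\<^sup>2 * u + t ^ (2 * n) * v = 0" if "0 \<le> t" for t
    using inv[of "t *\<^sub>R z"] that
    by (simp add: linear_scale[OF lin] radial_factor_scaleR u_def v_def algebra_simps)
  have "u + v = 0" "4 * u + 2 ^ (2 * n) * v = 0"
    using eq[of 1] eq[of 2] by simp_all
  then have "(2 ^ (2 * n) - 4) * v = 0"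
    unfolding left_diff_distrib by linarith
  moreover have "(2::real) ^ 2 < 2 ^ (2 * n)"
    using n by (intro power_strict_increasing) auto
  ultimately have "v = 0"
    by simp
  with \<open>u + v = 0\<close> have "u = 0"
    by simp
  with \<open>v = 0\<close> show "norm (\<gamma> z) = norm z" "chiral_form n (\<gamma> z) = chiral_form n z"
    by (simp_all add: u_def v_def)
qed

lemma symmetry_group_rotated_radial_map:
  assumes n: "2 \<le> n"
  shows "symmetry_group (rotated_radial_map n) = rotation_group n"
proof
  show "rotation_group n \<subseteq> symmetry_group (rotated_radial_map n)"
  proof
    fix \<gamma> assume "\<gamma> \<in> rotation_group n"
    then obtain c where c: "c ^ n = 1" and \<gamma>: "\<gamma> = (\<lambda>z. c * z)"
      using n by (auto simp: rotation_group_eq)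
    then have "c \<noteq> 0"
      using n by (auto simp: power_0_left)
    have "linear \<gamma>"
      unfolding \<gamma> by (rule bounded_linear.linear[OF bounded_linear_mult_right])
    moreover have "bij \<gamma>"
      unfolding \<gamma> using \<open>c \<noteq> 0\<close>
      by (intro bij_betw_byWitness[where f' = "\<lambda>z. inverse c * z"]) (auto simp flip: mult.assoc)
    moreover have "rotated_radial_map n (\<gamma> z) = \<gamma> (rotated_radial_map n z)" for z
      using radial_factor_rotate[OF _ c] n
      by (simp add: \<gamma> rotated_radial_map_def rotation_def mult.left_commute)
    ultimately show "\<gamma> \<in> symmetry_group (rotated_radial_map n)"
      by (simp add: symmetry_group_def)
  qed
  show "symmetry_group (rotated_radial_map n) \<subseteq> rotation_group n"
  proof
    fix \<gamma> assume "\<gamma> \<in> symmetry_group (rotated_radial_map n)"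
    then have lin: "linear \<gamma>" and "bij \<gamma>"
      and "\<And>z. rotated_radial_map n (\<gamma> z) = \<gamma> (rotated_radial_map n z)"
      by (auto simp: symmetry_group_def)
    then have "radial_factor n (\<gamma> z) = radial_factor n z" for z
      by (rule linear_symmetry_preserves_radial_factor)
    note sep = radial_factor_symmetry_separates[OF n lin this]
    show "\<gamma> \<in> rotation_group n"
    proof (rule linear_isometry_complex_cases[OF lin sep(1)])
      fix c assume "norm c = 1" "\<gamma> = (\<lambda>z. c * z)"
      then show ?thesis
        using chiral_form_rotation_symmetry[of n c] sep(2) n by (auto simp: rotation_group_eq)
    next
      fix c assume "norm c = 1" "\<gamma> = (\<lambda>z. c * cnj z)"
      then show ?thesis
        using chiral_form_no_reflection_symmetry[of n c] sep(2) n by auto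
    qed
  qed
qed

theorem theorem3p1:
  fixes n :: nat
  assumes "n \<ge> 2"
  shows "\<exists>f :: complex \<Rightarrow> complex.
           differentiable_homeomorphism f \<and>
           symmetry_group f = rotation_group n \<and>
           Fix f = {0} \<and>
           local_attractor f 0 \<and>
           (\<exists>x. has_minimal_period f x n)"
proof (intro exI conjI)
  have "0 < n"
    using assms by simp
  then show "differentiable_homeomorphism (rotated_radial_map n)"
    "local_attractor (rotated_radial_map n) 0"
    "has_minimal_period (rotated_radial_map n) 1 n"
    by (simp_all add: differentiable_homeomorphism_def homeomorphism_rotated_radial_map
        differentiable_rotated_radial_map local_attractor_rotated_radial_map
        minimal_period_rotated_radial_map)
  show "symmetry_group (rotated_radial_map n) = rotation_group n" "Fix (rotated_radial_map n) = {0}"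
    using assms by (simp_all add: symmetry_group_rotated_radial_map Fix_rotated_radial_map)
qed

end
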